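(* Let $\Gamma$ be a non-elementary, non-discrete subgroup of $\mathrm{PSL}_2(\mathbb{R})$, let $k\in\mathbb{R}$ and let $\nu$ be a multiplier system of weight $k$ for $\Gamma$. Then: (1) if $k\neq 0$, then $M_u(\Gamma,k,\nu)=\{0\}$; (2) if $k=0$, then $M_u(\Gamma,k,\nu)=\mathbb{C}$ (the constant functions) when $\nu=1$, and $M_u(\Gamma,k,\nu)=\{0\}$ otherwise.
   Context: $\mathbb{H}$ is the upper half-plane; $\mathrm{PSL}_2(\mathbb{R})=\mathrm{SL}_2(\mathbb{R})/\{\pm I\}$, with its usual topology, acts on $\mathbb{H}\cup\mathbb{R}\cup\{\infty\}$ by Möbius transformations. A subgroup is elementary if it has a finite orbit in $\mathbb{H}\cup\mathbb{R}\cup\{\infty\}$. Let $\widetilde\Gamma\subset\mathrm{SL}_2(\mathbb{R})$ be the preimage of $\Gamma$. Real powers $(cz+d)^k$ are taken with the principal branch of the logarithm. A multiplier system of weight $k\in\mathbb{R}$ for $\Gamma$ is a function $\nu:\widetilde\Gamma\to\{w\in\mathbb{C}:|w|=1\}$ such that $\mu_\gamma(z)=\nu(\gamma)(cz+d)^k$, for $\gamma=\begin{pmatrix}a&b\\c&d\end{pmatrix}\in\widetilde\Gamma$ and $z\in\mathbb{H}$, satisfies $\mu_{\alpha\gamma}(z)=\mu_\alpha(\gamma z)\mu_\gamma(z)$ and $\mu_{-\gamma}(z)=\mu_\gamma(z)$ for all $\alpha,\gamma\in\widetilde\Gamma$, $z\in\mathbb{H}$. $M_u(\Gamma,k,\nu)$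 is the complex vector space of unrestricted automorphic forms of weight $k$ and multiplier system $\nu$ for $\Gamma$, i.e. meromorphic functions $f$ on $\mathbb{H}$ with $(cz+d)^{-k}f(\gamma z)=\nu(\gamma)f(z)$ for all $\gamma=\begin{pmatrix}a&b\\c&d\end{pmatrix}\in\widetilde\Gamma$. *)

theory Defs
  imports "HOL-Complex_Analysis.Complex_Analysis" "HOL-Algebra.Algebra"
begin

section \<open>The groups \<open>SL\<^sub>2(\<real>)\<close> and \<open>PSL\<^sub>2(\<real>)\<close>\<close>

definition SL2R :: "(real^2^2) monoid" where
  "SL2R = \<lparr>carrier = {A. det A = 1}, mult = (**), one = mat 1\<rparr>"

definition PSL2R :: "(real^2^2) set monoid" where
  "PSL2R = SL2R Mod {mat 1, - mat 1}"

definition PSL2R_proj :: "real^2^2 \<Rightarrow> (real^2^2) set" where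
  "PSL2R_proj A = {mat 1, - mat 1} #>\<^bsub>SL2R\<^esub> A"

lemma group_SL2R: "group SL2R"
proof (rule groupI)
  fix A assume "A \<in> carrier SL2R"
  hence A: "det A = 1" by (simp add: SL2R_def)
  then obtain B where B: "B ** A = mat 1"
    by (metis invertible_det_nz invertible_def zero_neq_one)
  moreover from B A have "det B = 1"
    by (metis det_I det_mul mult.right_neutral)
  ultimately show "\<exists>B\<in>carrier SL2R. B \<otimes>\<^bsub>SL2R\<^esub> A = \<one>\<^bsub>SL2R\<^esub>"
    by (auto simp: SL2R_def)
qed (auto simp: SL2R_def det_mul matrix_mul_assoc)

lemma PSL2R_proj_eq: "PSL2R_proj A = {A, - A}"
proof -
  have "(- mat 1) ** A = - A"
    using matrix_mul_lid[of A]
    by (simp add: vec_eq_iff matrix_matrix_mult_def sum_negf)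
  thus ?thesis
    by (auto simp: PSL2R_proj_def r_coset_def SL2R_def)
qed

lemma normal_pm_SL2R: "{mat 1, - mat 1} \<lhd> SL2R"
proof -
  interpret group SL2R by (rule group_SL2R)
  have lneg: "(- A) ** B = - (A ** B)" for A B :: "real^2^2"
    by (simp add: vec_eq_iff matrix_matrix_mult_def sum_negf)
  have rneg: "A ** (- B) = - (A ** B)" for A B :: "real^2^2"
    by (simp add: vec_eq_iff matrix_matrix_mult_def sum_negf)
  have det1: "det (- mat 1 :: real^2^2) = 1"
    by (simp add: det_2 mat_def)
  have inv_neg: "inv\<^bsub>SL2R\<^esub> (- mat 1) = - mat 1"
    by (rule inv_equality) (simp_all add: SL2R_def det1 lneg rneg)
  have inv_1: "inv\<^bsub>SL2R\<^esub> (mat 1) = mat 1"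
    using inv_one by (simp add: SL2R_def)
  have "subgroup {mat 1, - mat 1} SL2R"
  proof (rule subgroupI)
    show "{mat 1, - mat 1} \<subseteq> carrier SL2R"
      by (auto simp: SL2R_def det1)
  next
    fix A assume "A \<in> {mat 1, - mat 1 :: real^2^2}"
    thus "inv\<^bsub>SL2R\<^esub> A \<in> {mat 1, - mat 1}"
      using inv_neg inv_1 by auto
  next
    fix A B assume "A \<in> {mat 1, - mat 1 :: real^2^2}" "B \<in> {mat 1, - mat 1 :: real^2^2}"
    thus "A \<otimes>\<^bsub>SL2R\<^esub> B \<in> {mat 1, - mat 1}"
      by (auto simp: SL2R_def lneg rneg)
  qed auto
  thus ?thesis
    by (rule normalI) (auto simp: SL2R_def r_coset_def l_coset_def lneg rneg)
qed

lemma group_PSL2R: "group PSL2R"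
  unfolding PSL2R_def by (rule normal.factorgroup_is_group[OF normal_pm_SL2R])

lemma carrier_PSL2R: "carrier PSL2R = PSL2R_proj ` carrier SL2R"
  by (auto simp: PSL2R_def FactGroup_def RCOSETS_def PSL2R_proj_def)

definition PSL2R_topology :: "(real^2^2) set topology" where
  "PSL2R_topology = topology (\<lambda>U. U \<subseteq> carrier PSL2R \<and>
     openin (top_of_set (carrier SL2R)) {A \<in> carrier SL2R. PSL2R_proj A \<in> U})"

lemma openin_PSL2R_topology:
  "openin PSL2R_topology U \<longleftrightarrow> U \<subseteq> carrier PSL2R \<and>
     openin (top_of_set (carrier SL2R)) {A \<in> carrier SL2R. PSL2R_proj A \<in> U}"
proof -
  let ?pre = "\<lambda>U. {A \<in> carrier SL2R. PSL2R_proj A \<in> U}"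
  have "istopology (\<lambda>U. U \<subseteq> carrier PSL2R \<and> openin (top_of_set (carrier SL2R)) (?pre U))"
    unfolding istopology_def
  proof (intro conjI allI impI)
    fix S T
    assume "S \<subseteq> carrier PSL2R \<and> openin (top_of_set (carrier SL2R)) (?pre S)"
       and "T \<subseteq> carrier PSL2R \<and> openin (top_of_set (carrier SL2R)) (?pre T)"
    moreover have "?pre (S \<inter> T) = ?pre S \<inter> ?pre T" by auto
    ultimately show "S \<inter> T \<subseteq> carrier PSL2R"
      and "openin (top_of_set (carrier SL2R)) (?pre (S \<inter> T))" by auto
  next
    fix K
    assume K: "\<forall>S\<in>K. S \<subseteq> carrier PSL2R \<and> openin (top_of_set (carrier SL2R)) (?pre S)"
    have eq: "?pre (\<Union>K) = \<Union>(?pre ` K)" by auto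
    show "\<Union>K \<subseteq> carrier PSL2R" using K by auto
    show "openin (top_of_set (carrier SL2R)) (?pre (\<Union>K))"
      unfolding eq using K by (intro openin_Union) auto
  qed
  thus ?thesis
    by (simp add: PSL2R_topology_def topology_inverse')
qed

lemma topspace_PSL2R_topology: "topspace PSL2R_topology = carrier PSL2R"
proof -
  have eq: "{A \<in> carrier SL2R. PSL2R_proj A \<in> carrier PSL2R} = carrier SL2R"
    by (auto simp: carrier_PSL2R)
  have "openin PSL2R_topology (carrier PSL2R)"
    unfolding openin_PSL2R_topology eq by simp
  thus ?thesis
    by (metis openin_PSL2R_topology openin_subset openin_topspace subset_antisym)
qed

lemma quotient_map_PSL2R_proj:
  "quotient_map (top_of_set (carrier SL2R)) PSL2R_topology PSL2R_proj"
  unfolding quotient_map_def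
  by (auto simp: topspace_PSL2R_topology carrier_PSL2R openin_PSL2R_topology)

definition discrete_PSL2R :: "(real^2^2) set set \<Rightarrow> bool" where
  "discrete_PSL2R \<Gamma> \<longleftrightarrow> subtopology PSL2R_topology \<Gamma> = discrete_topology \<Gamma>"

definition SL2R_preimage :: "(real^2^2) set set \<Rightarrow> (real^2^2) set" where
  "SL2R_preimage \<Gamma> = {A \<in> carrier SL2R. PSL2R_proj A \<in> \<Gamma>}"


section \<open>The action by Moebius transformations\<close>

definition upper_half_plane :: "complex set" where
  "upper_half_plane = {z. Im z > 0}"

definition moebius_mat :: "real^2^2 \<Rightarrow> complex \<Rightarrow> complex" where
  "moebius_mat A = moebius (of_real (A$1$1)) (of_real (A$1$2)) (of_real (A$2$1)) (of_real (A$2$2))"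

definition moebius_denom :: "real^2^2 \<Rightarrow> complex \<Rightarrow> complex" where
  "moebius_denom A z = of_real (A$2$1) * z + of_real (A$2$2)"

text \<open>The point \<open>\<infinity>\<close> is \<^term>\<open>None\<close>; a point \<open>z\<close> of the plane is \<^term>\<open>Some z\<close>.\<close>

definition extended_half_plane :: "complex option set" where
  "extended_half_plane = Some ` (upper_half_plane \<union> \<real>) \<union> {None}"

definition moebius_ext :: "real^2^2 \<Rightarrow> complex option \<Rightarrow> complex option" where
  "moebius_ext A p = (case p of
     None \<Rightarrow> if A$2$1 = 0 then None else Some (of_real (A$1$1 / A$2$1))
   | Some z \<Rightarrow> if moebius_denom A z = 0 then None else Some (moebius_mat A z))"

lemma moebius_ext_uminus: "moebius_ext (- A) p = moebius_ext A p"
proof -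
  have num: "- (of_real (A$1$1) * z) - of_real (A$1$2)
      = - (of_real (A$1$1) * z + of_real (A$1$2))" for z :: complex
    by simp
  have den: "- (of_real (A$2$1) * z) - of_real (A$2$2)
      = - (of_real (A$2$1) * z + of_real (A$2$2))" for z :: complex
    by simp
  show ?thesis
    by (cases p) (simp_all add: moebius_ext_def moebius_denom_def moebius_mat_def
        moebius_def num den neg_eq_iff_add_eq_0 del: minus_add_distrib)
qed

text \<open>
  Since \<open>A\<close> and \<open>- A\<close> act in the same way, the orbit of \<open>p\<close> under \<open>\<Gamma>\<close> is the orbit of \<open>p\<close>
  under the preimage of \<open>\<Gamma>\<close> in \<open>SL\<^sub>2(\<real>)\<close>.
\<close>

definition elementary_PSL2R :: "(real^2^2) set set \<Rightarrow> bool" where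
  "elementary_PSL2R \<Gamma> \<longleftrightarrow>
     (\<exists>p\<in>extended_half_plane. finite ((\<lambda>A. moebius_ext A p) ` SL2R_preimage \<Gamma>))"


section \<open>Multiplier systems and unrestricted automorphic forms\<close>

definition automorphy_factor ::
    "real \<Rightarrow> (real^2^2 \<Rightarrow> complex) \<Rightarrow> real^2^2 \<Rightarrow> complex \<Rightarrow> complex" where
  "automorphy_factor k \<nu> A z = \<nu> A * moebius_denom A z powr of_real k"

definition multiplier_system ::
    "(real^2^2) set set \<Rightarrow> real \<Rightarrow> (real^2^2 \<Rightarrow> complex) \<Rightarrow> bool" where
  "multiplier_system \<Gamma> k \<nu> \<longleftrightarrow>
     (\<forall>A\<in>SL2R_preimage \<Gamma>. norm (\<nu> A) = 1) \<and>
     (\<forall>A\<in>SL2R_preimage \<Gamma>. \<forall>B\<in>SL2R_preimage \<Gamma>. \<forall>z\<in>upper_half_plane.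
        automorphy_factor k \<nu> (A ** B) z =
          automorphy_factor k \<nu> A (moebius_mat B z) * automorphy_factor k \<nu> B z) \<and>
     (\<forall>A\<in>SL2R_preimage \<Gamma>. \<forall>z\<in>upper_half_plane.
        automorphy_factor k \<nu> (- A) z = automorphy_factor k \<nu> A z)"

text \<open>
  A meromorphic function on the upper half-plane is represented by a function that takes its
  limit value at every regular point, \<open>0\<close> at every pole and \<open>0\<close> outside the upper half-plane,
  so that distinct representatives are distinct meromorphic functions. With this convention the
  transformation law can be required at every point: by the law at nearby points, \<open>z\<close> is a pole
  iff its image is, and both sides then vanish.
\<close>

definition meromorphic_on_uhp :: "(complex \<Rightarrow> complex) \<Rightarrow> bool" where
  "meromorphic_on_uhp f \<longleftrightarrow>
     f nicely_meromorphic_on upper_half_plane \<and> (\<forall>z. z \<notin> upper_half_plane \<longrightarrow> f z = 0)"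

definition const_uhp :: "complex \<Rightarrow> complex \<Rightarrow> complex" where
  "const_uhp w z = (if z \<in> upper_half_plane then w else 0)"

definition unrestricted_forms ::
    "(real^2^2) set set \<Rightarrow> real \<Rightarrow> (real^2^2 \<Rightarrow> complex) \<Rightarrow> (complex \<Rightarrow> complex) set" where
  "unrestricted_forms \<Gamma> k \<nu> = {f. meromorphic_on_uhp f \<and>
     (\<forall>A\<in>SL2R_preimage \<Gamma>. \<forall>z\<in>upper_half_plane.
        moebius_denom A z powr of_real (- k) * f (moebius_mat A z) = \<nu> A * f z)}"

end

theory Submission
  imports Defs "HOL-Computational_Algebra.Fundamental_Theorem_Algebra"
begin

text \<open>
  For a form \<open>f\<close> the function \<open>|f(z)| (Im z)\<^bsup>k/2\<^esup>\<close> is invariant under \<open>\<Gamma>\<close>. Since \<open>\<Gamma>\<close> is not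
  discrete, there are \<open>A\<^sub>n \<rightarrow> 1\<close> in its preimage with \<open>(A\<^sub>n - 1) / \<epsilon>\<^sub>n \<rightarrow> Y \<noteq> 0\<close>; differentiating along
  \<open>A\<^sub>n z - z\<close> gives \<open>Re (w(z) Q\<^sub>Y(z)) = 0\<close> wherever \<open>f\<close> is regular and nonzero, where
  \<open>w = f'/f - \<i> k / (2 Im z)\<close> and \<open>Q\<^sub>Y\<close> is the quadratic vector field of \<open>Y \<in> sl\<^sub>2(\<real>)\<close>. If all
  conjugates of \<open>Y\<close> were parallel to \<open>Y\<close>, the zeros of \<open>Q\<^sub>Y\<close> would form a finite invariant set; so
  there is a conjugate \<open>Y'\<close> not parallel to \<open>Y\<close>. Were \<open>w\<close> nonzero somewhere, \<open>Q\<^sub>Y\<^sub>' / Q\<^sub>Y\<close> would be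
  real on an open set, hence constant, which is impossible. Thus \<open>f'/f = \<i> k / (2 Im z)\<close>, and a
  holomorphic function with imaginary values is constant, so \<open>k = 0\<close> and \<open>f' = 0\<close>.
\<close>

section \<open>Moebius transformations and the quadratic vector field\<close>

no_notation fps_nth (infixl "$" 75)

text \<open>The velocity at \<open>t = 0\<close> of the flow of \<open>exp (t Y)\<close>. It is
  defined for every trace because it is also evaluated at \<open>A - mat 1\<close>.\<close>

definition moebius_field :: "real^2^2 \<Rightarrow> complex \<Rightarrow> complex" where
  "moebius_field Y z = of_real (Y$1$2) + of_real (Y$1$1 - Y$2$2) * z - of_real (Y$2$1) * z^2"

text \<open>Tangent directions at the identity along sequences inside \<open>S\<close> itself: a
  function invariant under \<open>S\<close> can be differentiated along them even if
  \<open>S\<close> contains no one-parameter group.\<close>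

definition limit_direction :: "(real^2^2) set \<Rightarrow> real^2^2 \<Rightarrow> bool" where
  "limit_direction S Y \<longleftrightarrow> (\<exists>A \<epsilon>. (\<forall>n. A n \<in> S \<and> \<epsilon> n > 0) \<and> \<epsilon> \<longlonglongrightarrow> 0 \<and>
     (\<lambda>n::nat. (1 / \<epsilon> n) *\<^sub>R (A n - mat 1)) \<longlonglongrightarrow> Y)"

lemma matrix_mult_2_nth [simp]:
  fixes A B :: "'a::semiring_1^2^2"
  shows "(A ** B) $ i $ j = A$i$1 * B$1$j + A$i$2 * B$2$j"
  by (simp add: matrix_matrix_mult_def sum_2)

lemma matrix_eq_2:
  fixes A B :: "'a^2^2"
  shows "A = B \<longleftrightarrow> A$1$1 = B$1$1 \<and> A$1$2 = B$1$2 \<and> A$2$1 = B$2$1 \<and> A$2$2 = B$2$2"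
  by (auto simp: vec_eq_iff forall_2)

lemma mat_1_nth_2 [simp]:
  "(mat 1 :: 'a::zero_neq_one^2^2) $ 1 $ 1 = 1" "(mat 1 :: 'a^2^2) $ 1 $ 2 = 0"
  "(mat 1 :: 'a^2^2) $ 2 $ 1 = 0" "(mat 1 :: 'a^2^2) $ 2 $ 2 = 1"
  by (simp_all add: mat_def)

lemma carrier_SL2R_iff: "A \<in> carrier SL2R \<longleftrightarrow> A$1$1 * A$2$2 - A$1$2 * A$2$1 = 1"
  by (simp add: SL2R_def det_2)

lemma moebius_denom_nonzero:
  assumes "A \<in> carrier SL2R" "z \<in> upper_half_plane"
  shows "moebius_denom A z \<noteq> 0"
proof
  assume *: "moebius_denom A z = 0"
  hence "Im (moebius_denom A z) = 0" "Re (moebius_denom A z) = 0" by simp_all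
  hence "A$2$1 = 0 \<and> A$2$2 = 0"
    using assms(2) by (auto simp: moebius_denom_def upper_half_plane_def)
  thus False using assms(1) by (simp add: carrier_SL2R_iff)
qed

lemma Im_moebius_mat:
  assumes "A \<in> carrier SL2R" "z \<in> upper_half_plane"
  shows "Im (moebius_mat A z) = Im z / (norm (moebius_denom A z))\<^sup>2"
proof -
  have "Im (moebius_mat A z) = ((A$1$1 * A$2$2 - A$1$2 * A$2$1) * Im z) / (norm (moebius_denom A z))\<^sup>2"
    unfolding moebius_mat_def moebius_def moebius_denom_def cmod_power2 Im_divide
    by (simp add: algebra_simps)
  thus ?thesis using assms by (simp add: carrier_SL2R_iff)
qed

lemma moebius_mat_in_upper_half_plane:
  assumes "A \<in> carrier SL2R" "z \<in> upper_half_plane"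
  shows "moebius_mat A z \<in> upper_half_plane"
  using Im_moebius_mat[OF assms] moebius_denom_nonzero[OF assms] assms(2)
  by (simp add: upper_half_plane_def)

text \<open>An exact identity, not a first-order expansion: the numerator of
  \<open>(a z + b) / (c z + d) - z\<close> is \<open>b + (a - d) z - c z^2\<close>, to which
  \<open>mat 1\<close> contributes nothing.\<close>

lemma moebius_mat_diff:
  assumes "moebius_denom A z \<noteq> 0"
  shows "moebius_mat A z - z = moebius_field (A - mat 1) z / moebius_denom A z"
  using assms unfolding moebius_mat_def moebius_def moebius_denom_def moebius_field_def
  by (simp add: divide_simps) (simp add: algebra_simps power2_eq_square)

lemma moebius_field_scaleR: "moebius_field (c *\<^sub>R Y) z = of_real c * moebius_field Y z"
  by (simp add: moebius_field_def algebra_simps)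

lemma moebius_field_diff: "moebius_field (B - Y) z = moebius_field B z - moebius_field Y z"
  by (simp add: moebius_field_def algebra_simps)

text \<open>For trace zero the three coefficients determine \<open>Y\<close>, so
  \<open>Y \<noteq> 0\<close> gives a nonzero polynomial.\<close>

lemma finite_moebius_field_roots:
  assumes "trace Y = 0" "Y \<noteq> 0"
  shows "finite {z. moebius_field Y z = 0}"
proof -
  let ?p = "[:of_real (Y$1$2), of_real (Y$1$1 - Y$2$2), - of_real (Y$2$1):] :: complex poly"
  have "Y$1$1 = - Y$2$2" using assms(1) by (simp add: trace_def sum_2)
  hence "?p \<noteq> 0" using assms(2) by (auto simp: matrix_eq_2)
  moreover have "poly ?p z = moebius_field Y z" for z
    by (simp add: moebius_field_def algebra_simps power2_eq_square)
  ultimately show ?thesis using poly_roots_finite[of ?p] by simp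
qed

lemma holomorphic_moebius_field [holomorphic_intros]: "moebius_field Y holomorphic_on S"
  unfolding moebius_field_def by (intro holomorphic_intros)

section \<open>Tangent directions at the identity\<close>

lemma bounded_linear_matrix_conj:
  fixes A B :: "real^2^2"
  shows "bounded_linear (\<lambda>V. A ** V ** B)"
proof -
  have "linear (\<lambda>V. A ** V ** B)"
    by (intro linearI) (simp_all add: matrix_eq_2 algebra_simps)
  thus ?thesis by (simp add: linear_conv_bounded_linear)
qed

lemma limit_direction_tendsto_1:
  assumes "\<epsilon> \<longlonglongrightarrow> 0" "\<And>n. \<epsilon> n > 0"
    and "(\<lambda>n::nat. (1 / \<epsilon> n) *\<^sub>R (A n - (mat 1 :: real^2^2))) \<longlonglongrightarrow> Y"
  shows "A \<longlonglongrightarrow> mat 1"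
proof -
  have "(\<lambda>n. mat 1 + \<epsilon> n *\<^sub>R ((1 / \<epsilon> n) *\<^sub>R (A n - mat 1))) \<longlonglongrightarrow> mat 1 + 0 *\<^sub>R Y"
    by (intro tendsto_intros assms)
  moreover have "mat 1 + \<epsilon> n *\<^sub>R ((1 / \<epsilon> n) *\<^sub>R (A n - mat 1)) = A n" for n
    using assms(2)[of n] by simp
  ultimately show ?thesis by simp
qed

text \<open>Dividing \<open>det (1 + \<epsilon> Y) = 1 + \<epsilon> tr Y + \<epsilon>\<^sup>2 det Y = 1\<close> by \<open>\<epsilon>\<close>.\<close>
lemma trace_limit_direction:
  assumes "limit_direction S Y" "S \<subseteq> carrier SL2R"
  shows "trace Y = 0"
proof -
  obtain A \<epsilon> where A: "\<And>n. A n \<in> S" "\<And>n. \<epsilon> n > 0" "\<epsilon> \<longlonglongrightarrow> 0"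
    and lim: "(\<lambda>n::nat. (1 / \<epsilon> n) *\<^sub>R (A n - mat 1)) \<longlonglongrightarrow> Y"
    using assms(1) unfolding limit_direction_def by blast
  define B where "B = (\<lambda>n. (1 / \<epsilon> n) *\<^sub>R (A n - mat 1))"
  have B: "(\<lambda>n. B n $ i $ j) \<longlonglongrightarrow> Y $ i $ j" for i j
    unfolding B_def by (intro tendsto_vec_nth lim)
  have "B n $ 1 $ 1 + B n $ 2 $ 2 + \<epsilon> n * (B n $ 1 $ 1 * B n $ 2 $ 2 - B n $ 1 $ 2 * B n $ 2 $ 1) = 0" for n
  proof -
    have An: "A n = mat 1 + \<epsilon> n *\<^sub>R B n" using A(2)[of n] by (simp add: B_def)
    have "A n \<in> carrier SL2R" using A(1) assms(2) by auto
    hence "\<epsilon> n * (B n $ 1 $ 1 + B n $ 2 $ 2 + \<epsilon> n * (B n $ 1 $ 1 * B n $ 2 $ 2 - B n $ 1 $ 2 * B n $ 2 $ 1)) = 0"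
      unfolding carrier_SL2R_iff An by (simp add: algebra_simps)
    thus ?thesis using A(2)[of n] by simp
  qed
  moreover have "(\<lambda>n. B n $ 1 $ 1 + B n $ 2 $ 2 + \<epsilon> n * (B n $ 1 $ 1 * B n $ 2 $ 2 - B n $ 1 $ 2 * B n $ 2 $ 1))
     \<longlonglongrightarrow> Y $ 1 $ 1 + Y $ 2 $ 2 + 0 * (Y $ 1 $ 1 * Y $ 2 $ 2 - Y $ 1 $ 2 * Y $ 2 $ 1)"
    by (intro tendsto_intros B A)
  ultimately show ?thesis
    by (simp add: trace_def sum_2 LIMSEQ_const_iff)
qed

text \<open>Conjugation is linear and fixes \<open>mat 1\<close>, so it transports the difference
  quotients with the same scales \<open>\<epsilon>\<close>.\<close>

lemma limit_direction_conj:
  assumes "limit_direction S Y" "g ** g' = mat 1" "\<And>A. A \<in> S \<Longrightarrow> g ** A ** g' \<in> S"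
  shows "limit_direction S (g ** Y ** g')"
proof -
  obtain A \<epsilon> where A: "\<And>n. A n \<in> S" "\<And>n. \<epsilon> n > 0" "\<epsilon> \<longlonglongrightarrow> 0"
    and lim: "(\<lambda>n::nat. (1 / \<epsilon> n) *\<^sub>R (A n - mat 1)) \<longlonglongrightarrow> Y"
    using assms(1) unfolding limit_direction_def by blast
  interpret bounded_linear "\<lambda>B. g ** B ** g'" by (rule bounded_linear_matrix_conj)
  have "(\<lambda>n. (1 / \<epsilon> n) *\<^sub>R (g ** A n ** g' - mat 1)) \<longlonglongrightarrow> g ** Y ** g'"
    using tendsto[OF lim] assms(2) by (simp add: scaleR diff)
  thus ?thesis unfolding limit_direction_def
    by (intro exI[of _ "\<lambda>n. g ** A n ** g'"] exI[of _ \<epsilon>]) (simp add: A assms(3))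
qed

text \<open>Dividing \<open>A n - mat 1\<close> by its own norm puts the quotients on the unit
  sphere; by compactness a subsequence converges, and its limit has norm 1.\<close>

lemma limit_direction_exists:
  fixes S :: "(real^2^2) set"
  assumes "\<And>e. e > 0 \<Longrightarrow> \<exists>A\<in>S. A \<noteq> mat 1 \<and> dist A (mat 1) < e"
  obtains Y where "limit_direction S Y" "Y \<noteq> 0"
proof -
  have "\<exists>A\<in>S. A \<noteq> mat 1 \<and> dist A (mat 1) < 1 / real (Suc n)" for n
    by (rule assms) simp
  then obtain A where A: "\<And>n. A n \<in> S" "\<And>n. A n \<noteq> mat 1"
      "\<And>n. dist (A n) (mat 1) < 1 / real (Suc n)" by metis
  define \<epsilon> where "\<epsilon> n = norm (A n - mat 1)" for n
  have \<epsilon>: "\<epsilon> n > 0" "\<epsilon> n < 1 / real (Suc n)" for n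
    using A(2,3)[of n] by (simp_all add: \<epsilon>_def dist_norm)
  have "\<epsilon> \<longlonglongrightarrow> 0"
    by (rule tendsto_sandwich[of "\<lambda>_. 0" _ _ "\<lambda>n. 1 / real (Suc n)"])
       (use \<epsilon> LIMSEQ_inverse_real_of_nat in \<open>auto intro!: always_eventually less_imp_le simp: inverse_eq_divide\<close>)
  have "seq_compact (sphere (0 :: real^2^2) 1)"
    by (simp add: compact_imp_seq_compact)
  moreover have "\<forall>n. (1 / \<epsilon> n) *\<^sub>R (A n - mat 1) \<in> sphere 0 1"
    using A(2) by (simp add: \<epsilon>_def)
  ultimately obtain Y r where Y: "Y \<in> sphere 0 1" "strict_mono (r :: nat \<Rightarrow> nat)"
      "((\<lambda>n. (1 / \<epsilon> n) *\<^sub>R (A n - mat 1)) \<circ> r) \<longlonglongrightarrow> Y"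
    by (rule seq_compactE)
  have "limit_direction S Y"
    unfolding limit_direction_def
  proof (intro exI conjI)
    show "\<forall>n. (A \<circ> r) n \<in> S \<and> (\<epsilon> \<circ> r) n > 0" using A \<epsilon> by simp
    show "(\<epsilon> \<circ> r) \<longlonglongrightarrow> 0" by (rule LIMSEQ_subseq_LIMSEQ) fact+
    show "(\<lambda>n. (1 / (\<epsilon> \<circ> r) n) *\<^sub>R ((A \<circ> r) n - mat 1)) \<longlonglongrightarrow> Y"
      using Y(3) by (simp add: o_def)
  qed
  moreover have "Y \<noteq> 0" using Y(1) by auto
  ultimately show ?thesis using that by blast
qed

section \<open>Zeros of the vector field and their invariance\<close>

text \<open>The fixed points of the one-parameter group generated by \<open>Y\<close>.\<close>
definition moebius_field_zeros :: "real^2^2 \<Rightarrow> complex option set" where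
  "moebius_field_zeros Y = Some ` {z. moebius_field Y z = 0} \<union> (if Y$2$1 = 0 then {None} else {})"

lemma moebius_field_zeros_nonempty:
  "moebius_field_zeros Y \<inter> extended_half_plane \<noteq> {}"
proof (cases "Y$2$1 = 0")
  case True
  hence "None \<in> moebius_field_zeros Y \<inter> extended_half_plane"
    by (simp add: moebius_field_zeros_def extended_half_plane_def)
  thus ?thesis by blast
next
  case False
  let ?p = "[:of_real (Y$1$2), of_real (Y$1$1 - Y$2$2), - of_real (Y$2$1):] :: complex poly"
  obtain z where "poly ?p z = 0"
    using fundamental_theorem_of_algebra_alt[of ?p] False by auto
  hence z: "moebius_field Y z = 0"
    by (simp add: moebius_field_def algebra_simps power2_eq_square)
  \<comment> \<open>Real coefficients make the zeros symmetric about the real axis, so one of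
    \<open>z\<close> and \<open>cnj z\<close> lies in the closed upper half-plane.\<close>
  have "moebius_field Y (cnj z) = cnj (moebius_field Y z)"
    by (simp add: moebius_field_def)
  with z have z': "moebius_field Y (cnj z) = 0" by simp
  have "z \<in> upper_half_plane \<union> \<real> \<or> cnj z \<in> upper_half_plane \<union> \<real>"
    using linorder_less_linear[of "Im z" 0]
    by (auto simp: upper_half_plane_def complex_is_Real_iff)
  thus ?thesis
    using z z' by (auto simp: moebius_field_zeros_def extended_half_plane_def)
qed

text \<open>With \<open>x = (u, v)\<close>, \<open>q u v\<close> is the determinant of the columns
  \<open>Y x\<close> and \<open>x\<close>. Since \<open>g Y = t Y g\<close> and
  \<open>det g = 1\<close>, \<open>t\<close> times the determinant of \<open>Y g x\<close> and
  \<open>g x\<close> is that of \<open>g Y x\<close> and \<open>g x\<close>, hence that of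
  \<open>Y x\<close> and \<open>x\<close>. Below, \<open>?P\<close> and \<open>?R\<close> are the
  entries of \<open>Y x\<close>.\<close>

lemma quadratic_form_transform:
  fixes a b c d t u v :: "'a::comm_ring_1"
  assumes "a * Y1 + b * Y3 = t * (Y1 * a + Y2 * c)" "a * Y2 + b * Y4 = t * (Y1 * b + Y2 * d)"
    "c * Y1 + d * Y3 = t * (Y3 * a + Y4 * c)" "c * Y2 + d * Y4 = t * (Y3 * b + Y4 * d)"
    "a * d - b * c = 1"
  defines "q \<equiv> \<lambda>u v. Y2 * v^2 + (Y1 - Y4) * u * v - Y3 * u^2"
  shows "t * q (a * u + b * v) (c * u + d * v) = q u v"
proof -
  have q: "q u v = (Y1 * u + Y2 * v) * v - (Y3 * u + Y4 * v) * u" for u v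
    unfolding q_def by (simp add: algebra_simps power2_eq_square)
  let ?P = "Y1 * u + Y2 * v" and ?R = "Y3 * u + Y4 * v"
  let ?u = "a * u + b * v" and ?v = "c * u + d * v"
  have "t * (Y1 * ?u + Y2 * ?v) = t * (Y1 * a + Y2 * c) * u + t * (Y1 * b + Y2 * d) * v"
    by (simp add: algebra_simps)
  also have "\<dots> = a * ?P + b * ?R"
    unfolding assms(1,2)[symmetric] by (simp add: algebra_simps)
  finally have 1: "t * (Y1 * ?u + Y2 * ?v) = a * ?P + b * ?R" .
  have "t * (Y3 * ?u + Y4 * ?v) = t * (Y3 * a + Y4 * c) * u + t * (Y3 * b + Y4 * d) * v"
    by (simp add: algebra_simps)
  also have "\<dots> = c * ?P + d * ?R"
    unfolding assms(3,4)[symmetric] by (simp add: algebra_simps)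
  finally have 2: "t * (Y3 * ?u + Y4 * ?v) = c * ?P + d * ?R" .
  have "t * q ?u ?v = (t * (Y1 * ?u + Y2 * ?v)) * ?v - (t * (Y3 * ?u + Y4 * ?v)) * ?u"
    unfolding q by (simp add: algebra_simps)
  also have "\<dots> = (a * ?P + b * ?R) * ?v - (c * ?P + d * ?R) * ?u"
    unfolding 1 2 ..
  also have "\<dots> = (a * d - b * c) * (?P * v - ?R * u)"
    by (simp add: algebra_simps)
  finally show ?thesis unfolding assms(5) q by simp
qed

text \<open>In homogeneous coordinates the zeros, infinity included, are those of a binary quadratic
  form, which \<open>g\<close> only multiplies by a nonzero scalar.\<close>

lemma moebius_ext_field_zeros:
  assumes "g \<in> carrier SL2R" "g ** Y = t *\<^sub>R (Y ** g)" "t \<noteq> 0" "p \<in> moebius_field_zeros Y"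
  shows "moebius_ext g p \<in> moebius_field_zeros Y"
proof -
  \<comment> \<open>Homogenisation of \<open>moebius_field Y\<close>: a finite point
    \<open>z\<close> becomes \<open>(z, 1)\<close> and infinity \<open>(1, 0)\<close>.\<close>
  define q :: "complex \<Rightarrow> complex \<Rightarrow> complex" where
    "q u v = of_real (Y$1$2) * v^2 + of_real (Y$1$1 - Y$2$2) * u * v - of_real (Y$2$1) * u^2" for u v
  define a b c d where "a = g$1$1" and "b = g$1$2" and "c = g$2$1" and "d = g$2$2"
  note abcd = a_def b_def c_def d_def
  define Y1 Y2 Y3 Y4 where "Y1 = Y$1$1" and "Y2 = Y$1$2" and "Y3 = Y$2$1" and "Y4 = Y$2$2"
  note Ys = Y1_def Y2_def Y3_def Y4_def
  have comm: "a * Y1 + b * Y3 = t * (Y1 * a + Y2 * c)" "a * Y2 + b * Y4 = t * (Y1 * b + Y2 * d)"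
     "c * Y1 + d * Y3 = t * (Y3 * a + Y4 * c)" "c * Y2 + d * Y4 = t * (Y3 * b + Y4 * d)"
    using assms(2) by (simp_all add: matrix_eq_2 abcd Ys)
  have det: "a * d - b * c = 1" using assms(1) by (simp add: carrier_SL2R_iff abcd)
  have comm': "of_real a * of_real Y1 + of_real b * of_real Y3 = of_real t * (of_real Y1 * of_real a + of_real Y2 * of_real c :: complex)" 
     "of_real a * of_real Y2 + of_real b * of_real Y4 = of_real t * (of_real Y1 * of_real b + of_real Y2 * of_real d :: complex)"
     "of_real c * of_real Y1 + of_real d * of_real Y3 = of_real t * (of_real Y3 * of_real a + of_real Y4 * of_real c :: complex)"
     "of_real c * of_real Y2 + of_real d * of_real Y4 = of_real t * (of_real Y3 * of_real b + of_real Y4 * of_real d :: complex)"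
     "of_real a * of_real d - of_real b * of_real c = (1::complex)"
    using comm det by (simp_all flip: of_real_mult of_real_add of_real_diff)
  have q: "of_real t * q (of_real a * u + of_real b * v) (of_real c * u + of_real d * v) = q u v" for u v
    using quadratic_form_transform[OF comm'] unfolding q_def Ys[symmetric] of_real_diff .
  have field_q: "moebius_field Y z = q z 1" for z
    by (simp add: q_def moebius_field_def)
  have q_scale: "q (u / v) 1 = q u v / v^2" if "v \<noteq> 0" for u v
    using that by (simp add: q_def field_simps power2_eq_square)
  have zero_iff: "q (of_real a * u + of_real b * v) (of_real c * u + of_real d * v) = 0 \<longleftrightarrow> q u v = 0" for u v
    using q[of u v] assms(3) by (metis mult_eq_0_iff of_real_eq_0_iff)
  have inf: "None \<in> moebius_field_zeros Y \<longleftrightarrow> q 1 0 = 0"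
    by (auto simp: moebius_field_zeros_def q_def)
  have fin: "Some z \<in> moebius_field_zeros Y \<longleftrightarrow> q z 1 = 0" for z
    by (auto simp: moebius_field_zeros_def field_q)
  have main: "(if of_real c * u + of_real d * v = 0 then None
          else Some ((of_real a * u + of_real b * v) / (of_real c * u + of_real d * v))) \<in> moebius_field_zeros Y"
    if "q u v = 0" "u \<noteq> 0 \<or> v \<noteq> 0" for u v
  proof -
    have 0: "q (of_real a * u + of_real b * v) (of_real c * u + of_real d * v) = 0"
      using that(1) zero_iff by simp
    show ?thesis
    proof (cases "of_real c * u + of_real d * v = 0")
      case True
      hence "q (of_real a * u + of_real b * v) 0 = 0" using 0 by simp
      hence "Y3 = 0 \<or> of_real a * u + of_real b * v = 0" by (simp add: q_def Ys)
      \<comment> \<open>Cramer's rule with determinant 1: only the zero vector is mapped to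
        zero.\<close>
      moreover have "u = 0" "v = 0" if "of_real a * u + of_real b * v = 0"
      proof -
        have "of_real d * (of_real a * u + of_real b * v) - of_real b * (of_real c * u + of_real d * v)
            = (of_real a * of_real d - of_real b * of_real c) * u"
          by (simp add: algebra_simps)
        thus "u = 0" using that True comm'(5) by simp
        have "of_real a * (of_real c * u + of_real d * v) - of_real c * (of_real a * u + of_real b * v)
            = (of_real a * of_real d - of_real b * of_real c) * v"
          by (simp add: algebra_simps)
        thus "v = 0" using that True comm'(5) by simp
      qed
      ultimately have "Y3 = 0" using that(2) by blast
      thus ?thesis using True by (simp add: moebius_field_zeros_def Ys)
    next
      case False
      thus ?thesis using 0 by (simp add: fin q_scale)
    qed
  qed
  show ?thesis
  proof (cases p)
    case None
    thus ?thesis using main[of 1 0] assms(4) inf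
      by (simp add: moebius_ext_def abcd split: if_splits)
  next
    case (Some z)
    thus ?thesis using main[of z 1] assms(4) fin[of z]
      by (simp add: moebius_ext_def moebius_denom_def moebius_mat_def moebius_def abcd split: if_splits)
  qed
qed

section \<open>Non-discrete and non-elementary groups\<close>

lemma SL2R_preimage_subset: "SL2R_preimage \<Gamma> \<subseteq> carrier SL2R"
  by (auto simp: SL2R_preimage_def)

lemma group_hom_PSL2R_proj: "group_hom SL2R PSL2R PSL2R_proj"
proof (intro group_hom.intro group_hom_axioms.intro group_SL2R group_PSL2R)
  have "PSL2R_proj = (\<lambda>A. {mat 1, - mat 1} #>\<^bsub>SL2R\<^esub> A)"
    by (simp add: fun_eq_iff PSL2R_proj_def)
  thus "PSL2R_proj \<in> hom SL2R PSL2R"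
    unfolding PSL2R_def using normal.r_coset_hom_Mod[OF normal_pm_SL2R] by simp
qed

lemma subgroup_SL2R_preimage:
  assumes "subgroup \<Gamma> PSL2R"
  shows "subgroup (SL2R_preimage \<Gamma>) SL2R"
proof -
  interpret group_hom SL2R PSL2R PSL2R_proj by (rule group_hom_PSL2R_proj)
  show ?thesis
  proof (rule subgroup.intro)
    fix A assume "A \<in> SL2R_preimage \<Gamma>"
    thus "inv\<^bsub>SL2R\<^esub> A \<in> SL2R_preimage \<Gamma>"
      using subgroup.m_inv_closed[OF assms] by (auto simp: SL2R_preimage_def)
  next
    show "\<one>\<^bsub>SL2R\<^esub> \<in> SL2R_preimage \<Gamma>"
      using subgroup.one_closed[OF assms] hom_one by (simp add: SL2R_preimage_def)
  qed (use subgroup.m_closed[OF assms] in \<open>auto simp: SL2R_preimage_def\<close>)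
qed

lemma SL2R_preimage_mult:
  assumes "subgroup \<Gamma> PSL2R" "A \<in> SL2R_preimage \<Gamma>" "B \<in> SL2R_preimage \<Gamma>"
  shows "A ** B \<in> SL2R_preimage \<Gamma>"
  using subgroup.m_closed[OF subgroup_SL2R_preimage[OF assms(1)] assms(2,3)]
  by (simp add: SL2R_def)

lemma SL2R_preimage_inverse:
  assumes "subgroup \<Gamma> PSL2R" "A \<in> SL2R_preimage \<Gamma>"
  obtains B where "B \<in> SL2R_preimage \<Gamma>" "A ** B = mat 1" "B ** A = mat 1"
proof
  interpret group SL2R by (rule group_SL2R)
  have A: "A \<in> carrier SL2R" using assms(2) SL2R_preimage_subset by blast
  show "inv\<^bsub>SL2R\<^esub> A \<in> SL2R_preimage \<Gamma>"
    by (rule subgroup.m_inv_closed[OF subgroup_SL2R_preimage]) fact+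
  show "A ** inv\<^bsub>SL2R\<^esub> A = mat 1" "inv\<^bsub>SL2R\<^esub> A ** A = mat 1"
    using r_inv[OF A] l_inv[OF A] by (simp_all add: SL2R_def)
qed

text \<open>Contrapositive: if \<open>mat 1\<close> is isolated in the preimage, translation
  isolates every other element, and all singletons of \<open>\<Gamma>\<close> are open in the
  quotient topology.\<close>

lemma not_discrete_PSL2R_accumulates:
  assumes "subgroup \<Gamma> PSL2R" "\<not> discrete_PSL2R \<Gamma>" "e > 0"
  shows "\<exists>A\<in>SL2R_preimage \<Gamma>. A \<noteq> mat 1 \<and> dist A (mat 1) < e"
proof (rule ccontr)
  assume "\<not> ?thesis"
  hence isolated: "A = mat 1" if "A \<in> SL2R_preimage \<Gamma>" "dist A (mat 1) < e" for A
    using that by blast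
  have sub: "\<Gamma> \<subseteq> carrier PSL2R" by (rule subgroup.subset[OF assms(1)])
  have "openin (subtopology PSL2R_topology \<Gamma>) {x}" if x: "x \<in> \<Gamma>" for x
  proof -
    obtain A where A: "A \<in> carrier SL2R" "x = PSL2R_proj A"
      using x sub by (auto simp: carrier_PSL2R)
    hence A': "A \<in> SL2R_preimage \<Gamma>" using x by (simp add: SL2R_preimage_def)
    then obtain A1 where A1: "A1 \<in> SL2R_preimage \<Gamma>" "A ** A1 = mat 1" "A1 ** A = mat 1"
      using SL2R_preimage_inverse[OF assms(1)] by metis
    \<comment> \<open>The translate by \<open>A\<close> of the \<open>e\<close>-neighbourhood of
      \<open>mat 1\<close>; the right factor \<open>mat 1\<close> fits
      \<open>bounded_linear_matrix_conj\<close>.\<close>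
    define W where "W = {B. dist (A1 ** B ** mat 1) (mat 1) < e}"
    define U where "U = PSL2R_proj ` (carrier SL2R \<inter> W)"
    have cont: "continuous_on UNIV (\<lambda>B::real^2^2. A1 ** B ** (mat 1 :: real^2^2))"
      by (rule linear_continuous_on[OF bounded_linear_matrix_conj])
    have "open W"
      unfolding W_def by (intro open_Collect_less continuous_intros cont)
    moreover have "open (uminus ` W)"
      using \<open>open W\<close> by (rule open_negations)
    \<comment> \<open>The fibres are \<open>{B, - B}\<close>, so saturating \<open>W\<close> only
      adds its negative.\<close>
    moreover have "{B \<in> carrier SL2R. PSL2R_proj B \<in> U} = carrier SL2R \<inter> (W \<union> uminus ` W)"
    proof -
      have "- B \<in> carrier SL2R \<longleftrightarrow> B \<in> carrier SL2R" for B
        by (simp add: carrier_SL2R_iff)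
      thus ?thesis
        unfolding U_def PSL2R_proj_eq by (auto simp: doubleton_eq_iff image_iff) 
    qed
    ultimately have "openin (top_of_set (carrier SL2R)) {B \<in> carrier SL2R. PSL2R_proj B \<in> U}"
      by (simp add: openin_open_Int open_Un)
    hence "openin PSL2R_topology U"
      unfolding openin_PSL2R_topology by (auto simp: U_def carrier_PSL2R)
    moreover have "U \<inter> \<Gamma> = {x}"
    proof (intro equalityI subsetI)
      fix y assume "y \<in> U \<inter> \<Gamma>"
      then obtain B where B: "B \<in> carrier SL2R" "B \<in> W" "y = PSL2R_proj B" "y \<in> \<Gamma>"
        by (auto simp: U_def)
      hence "B \<in> SL2R_preimage \<Gamma>" by (simp add: SL2R_preimage_def)
      hence "A1 ** B \<in> SL2R_preimage \<Gamma>" by (rule SL2R_preimage_mult[OF assms(1) A1(1)])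
      hence "A1 ** B = mat 1" using isolated B(2) by (simp add: W_def)
      hence "A ** (A1 ** B) = A" by simp
      hence "B = A" by (simp add: matrix_mul_assoc A1(2))
      thus "y \<in> {x}" using A B by simp
    next
      fix y assume "y \<in> {x}"
      moreover have "A \<in> W" using assms(3) by (simp add: W_def A1)
      ultimately show "y \<in> U \<inter> \<Gamma>" using A x by (auto simp: U_def)
    qed
    ultimately show ?thesis unfolding openin_subtopology by metis
  qed
  moreover have "topspace (subtopology PSL2R_topology \<Gamma>) = \<Gamma>"
    using sub by (auto simp: topspace_PSL2R_topology)
  ultimately have "discrete_PSL2R \<Gamma>"
    unfolding discrete_PSL2R_def by (metis discrete_topology_unique)
  thus False using assms(2) by contradiction
qed

text \<open>Supplies a second direction independent of \<open>Y\<close>: otherwise a zero of the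
  field in the extended half-plane would have its whole orbit inside the finite set of
  zeros.\<close>

lemma not_elementary_PSL2R_conj:
  assumes "subgroup \<Gamma> PSL2R" "\<not> elementary_PSL2R \<Gamma>" "trace Y = 0" "Y \<noteq> 0"
  obtains g g' where "g \<in> SL2R_preimage \<Gamma>" "g' \<in> SL2R_preimage \<Gamma>" "g ** g' = mat 1"
    "\<And>t. g ** Y ** g' \<noteq> t *\<^sub>R Y"
proof (rule ccontr)
  assume "\<not> thesis"
  note parallel = that \<open>\<not> thesis\<close>
  obtain p where p: "p \<in> moebius_field_zeros Y" "p \<in> extended_half_plane"
    using moebius_field_zeros_nonempty by blast
  have "moebius_ext g p \<in> moebius_field_zeros Y" if g: "g \<in> SL2R_preimage \<Gamma>" for g
  proof -
    obtain g' where g': "g' \<in> SL2R_preimage \<Gamma>" "g ** g' = mat 1" "g' ** g = mat 1"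
      using SL2R_preimage_inverse[OF assms(1) g] .
    then obtain t where t: "g ** Y ** g' = t *\<^sub>R Y" using parallel g by metis
    have "g ** Y = g ** Y ** (g' ** g)" by (simp add: g')
    also have "\<dots> = (t *\<^sub>R Y) ** g" by (simp add: matrix_mul_assoc t)
    finally have gY: "g ** Y = t *\<^sub>R (Y ** g)" by (simp add: matrix_eq_2 algebra_simps)
    \<comment> \<open>Undoing the conjugation: \<open>t = 0\<close> would give
      \<open>Y = 0\<close>.\<close>
    have "Y = (g' ** g) ** Y" by (simp add: g')
    also have "\<dots> = g' ** (t *\<^sub>R (Y ** g))" by (simp add: gY flip: matrix_mul_assoc)
    finally have "t \<noteq> 0" using assms(4) by (auto simp: matrix_eq_2)
    thus ?thesis
      using moebius_ext_field_zeros[OF _ gY _ p(1)] g SL2R_preimage_subset by blast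
  qed
  moreover have "finite (moebius_field_zeros Y)"
    unfolding moebius_field_zeros_def using finite_moebius_field_roots[OF assms(3,4)] by simp
  ultimately have "finite ((\<lambda>g. moebius_ext g p) ` SL2R_preimage \<Gamma>)"
    by (meson finite_subset image_subsetI)
  thus False using p(2) assms(2) by (auto simp: elementary_PSL2R_def)
qed

section \<open>Two analytic tools\<close>

text \<open>The increment of \<open>h\<close> vanishes at \<open>x n\<close>, so the remainder of
  the linear approximation there is \<open>- D (x n - z)\<close>; it is
  \<open>o(\<epsilon> n)\<close>.\<close>

lemma has_derivative_invariant_direction:
  fixes h :: "'a::real_normed_vector \<Rightarrow> 'b::real_normed_vector" and x :: "nat \<Rightarrow> 'a"
  assumes h: "(h has_derivative D) (at z)"
    and \<epsilon>: "\<epsilon> \<longlonglongrightarrow> 0" "\<And>n. \<epsilon> n > 0"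
    and v: "(\<lambda>n. (1 / \<epsilon> n) *\<^sub>R (x n - z)) \<longlonglongrightarrow> v"
    and inv: "\<And>n. h (x n) = h z"
  shows "D v = 0"
proof -
  interpret D: bounded_linear D using h by (rule has_derivative_bounded_linear)
  \<comment> \<open>At \<open>y = z\<close> this is \<open>0 / 0 = 0\<close>, so \<open>r\<close> is
    continuous at \<open>z\<close> and the case \<open>x n = z\<close> need not be excluded.\<close>
  define r where "r y = norm (h y - h z - D (y - z)) / norm (y - z)" for y
  have "r \<midarrow>z\<rightarrow> 0"
    using h unfolding has_derivative_iff_norm r_def by simp
  hence "isCont r z" by (simp add: isCont_def r_def)
  have "(\<lambda>n. z + \<epsilon> n *\<^sub>R ((1 / \<epsilon> n) *\<^sub>R (x n - z))) \<longlonglongrightarrow> z + 0 *\<^sub>R v"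
    by (intro tendsto_intros \<epsilon> v)
  moreover have "z + \<epsilon> n *\<^sub>R ((1 / \<epsilon> n) *\<^sub>R (x n - z)) = x n" for n
    using \<epsilon>(2)[of n] by simp
  ultimately have "x \<longlonglongrightarrow> z" by simp
  hence "(\<lambda>n. r (x n)) \<longlonglongrightarrow> r z"
    using \<open>isCont r z\<close> by (simp add: isCont_tendsto_compose)
  hence "(\<lambda>n. r (x n) * norm ((1 / \<epsilon> n) *\<^sub>R (x n - z))) \<longlonglongrightarrow> 0 * norm v"
    by (intro tendsto_intros v) (simp add: r_def)
  moreover have "r (x n) * norm ((1 / \<epsilon> n) *\<^sub>R (x n - z)) = norm (D ((1 / \<epsilon> n) *\<^sub>R (x n - z)))" for n
    using \<epsilon>(2)[of n] by (cases "x n = z") (simp_all add: r_def inv D.scaleR D.zero)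
  ultimately have "(\<lambda>n. norm (D ((1 / \<epsilon> n) *\<^sub>R (x n - z)))) \<longlonglongrightarrow> 0" by simp
  moreover have "(\<lambda>n. norm (D ((1 / \<epsilon> n) *\<^sub>R (x n - z)))) \<longlonglongrightarrow> norm (D v)"
    by (intro tendsto_norm D.tendsto v)
  ultimately show ?thesis using LIMSEQ_unique norm_eq_zero by metis
qed

text \<open>By the open mapping theorem a nonconstant \<open>f\<close> would have an open image, but
  the real line contains no disc.\<close>

lemma holomorphic_real_imp_constant:
  assumes "f holomorphic_on S" "open S" "connected S" "\<And>z. z \<in> S \<Longrightarrow> Im (f z) = 0"
  shows "f constant_on S"
proof (rule ccontr)
  assume nc: "\<not> f constant_on S"
  hence "open (f ` S)"
    using open_mapping_thm[OF assms(1-3,2) subset_refl] by blast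
  moreover have "S \<noteq> {}" using nc by (auto simp: constant_on_def)
  then obtain z where z: "z \<in> S" by blast
  ultimately obtain e where e: "e > 0" "ball (f z) e \<subseteq> f ` S"
    by (meson imageI open_contains_ball)
  have "f z + of_real (e / 2) * \<i> \<in> ball (f z) e"
    using e(1) by (simp add: dist_norm norm_mult)
  then obtain y where "y \<in> S" "f y = f z + of_real (e / 2) * \<i>"
    using e(2) by (metis imageE subsetD)
  hence "Im (f y) = Im (f z) + e / 2" by simp
  thus False using assms(4) z \<open>y \<in> S\<close> e(1) by simp
qed

section \<open>The invariant size of a form and its derivative\<close>

lemma open_upper_half_plane: "open upper_half_plane"
  unfolding upper_half_plane_def by (rule open_halfspace_Im_gt)

lemma connected_upper_half_plane: "connected upper_half_plane"
  unfolding upper_half_plane_def by (intro convex_connected convex_halfspace_Im_gt)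

text \<open>Poles and points outside the half-plane carry the value 0, so a nonzero value certifies
  a regular point of the half-plane.\<close>

lemma unrestricted_form_analytic_at:
  assumes "f \<in> unrestricted_forms \<Gamma> k \<nu>" "f z \<noteq> 0"
  shows "z \<in> upper_half_plane" "f analytic_on {z}"
proof -
  have f: "f nicely_meromorphic_on upper_half_plane" "\<And>z. z \<notin> upper_half_plane \<Longrightarrow> f z = 0"
    using assms(1) by (auto simp: unrestricted_forms_def meromorphic_on_uhp_def)
  show z: "z \<in> upper_half_plane" using f(2) assms(2) by blast
  have "f \<midarrow>z\<rightarrow> f z" using f(1) z assms(2) by (auto simp: nicely_meromorphic_on_def)
  hence "\<not> is_pole f z"
    using at_neq_bot is_pole_def not_tendsto_and_filterlim_at_infinity by blast
  thus "f analytic_on {z}" by (rule nicely_meromorphic_on_imp_analytic_at[OF f(1) z])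
qed

lemma open_nonzero_unrestricted_form:
  assumes "f \<in> unrestricted_forms \<Gamma> k \<nu>"
  shows "open {z. f z \<noteq> 0}" "f holomorphic_on {z. f z \<noteq> 0}"
proof -
  have an: "f analytic_on {z}" if "f z \<noteq> 0" for z
    using unrestricted_form_analytic_at(2)[OF assms that] .
  hence "f analytic_on {z. f z \<noteq> 0}" by (subst analytic_on_analytic_at) auto
  thus "f holomorphic_on {z. f z \<noteq> 0}" by (rule analytic_imp_holomorphic)
  show "open {z. f z \<noteq> 0}"
  proof (subst open_subopen, intro ballI)
    fix z assume "z \<in> {z. f z \<noteq> 0}"
    hence z: "f z \<noteq> 0" by simp
    then obtain e where e: "e > 0" "f holomorphic_on ball z e"
      using an by (auto simp: analytic_on_def)
    have "open (ball z e \<inter> f -` (- {0}))"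
      by (rule continuous_open_preimage) (use e holomorphic_on_imp_continuous_on in auto)
    thus "\<exists>T. open T \<and> z \<in> T \<and> T \<subseteq> {z. f z \<noteq> 0}"
      by (rule exI[of _ "ball z e \<inter> f -` (- {0})", OF conjI]) (use e z in auto)
  qed
qed

text \<open>The factor \<open>k / 2\<close> balances the two changes: \<open>Im z\<close> is divided
  by \<open>|c z + d|^2\<close>, while \<open>|f|\<close> is multiplied by
  \<open>|c z + d|^k\<close>. Meaningful only where \<open>f z \<noteq> 0\<close> and
  \<open>Im z > 0\<close>.\<close>

definition log_size :: "real \<Rightarrow> (complex \<Rightarrow> complex) \<Rightarrow> complex \<Rightarrow> real" where
  "log_size k f z = ln (norm (f z)) + k / 2 * ln (Im z)"

lemma log_size_invariant:
  assumes "f \<in> unrestricted_forms \<Gamma> k \<nu>" "multiplier_system \<Gamma> k \<nu>"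
    and "A \<in> SL2R_preimage \<Gamma>" "f z \<noteq> 0"
  shows "log_size k f (moebius_mat A z) = log_size k f z"
proof -
  have A: "A \<in> carrier SL2R" using assms(3) by (simp add: SL2R_preimage_def)
  have z: "z \<in> upper_half_plane" using unrestricted_form_analytic_at(1)[OF assms(1,4)] .
  note d = moebius_denom_nonzero[OF A z]
  have Im: "Im z > 0" using z by (simp add: upper_half_plane_def)
  have "moebius_denom A z powr of_real (- k) * f (moebius_mat A z) = \<nu> A * f z"
    using assms(1,3) z by (auto simp: unrestricted_forms_def)
  hence "norm (moebius_denom A z powr of_real (- k)) * norm (f (moebius_mat A z)) = norm (\<nu> A) * norm (f z)"
    by (metis norm_mult)
  moreover have "norm (\<nu> A) = 1" using assms(2,3) by (simp add: multiplier_system_def)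
  \<comment> \<open>For a real exponent the norm of the power is the power of the norm, whatever the
    branch of the logarithm.\<close>
  ultimately have *: "norm (moebius_denom A z) powr (- k) * norm (f (moebius_mat A z)) = norm (f z)"
    by (simp add: norm_powr_real_powr')
  hence nz: "f (moebius_mat A z) \<noteq> 0" using assms(4) by auto
  have "ln (norm (f z)) = - k * ln (norm (moebius_denom A z)) + ln (norm (f (moebius_mat A z)))"
    unfolding *[symmetric] using d nz by (simp add: ln_mult ln_powr)
  moreover have "k / 2 * ln (Im (moebius_mat A z)) = k / 2 * ln (Im z) - k * ln (norm (moebius_denom A z))"
    unfolding Im_moebius_mat[OF A z] using d Im by (simp add: ln_div ln_realpow right_diff_distrib)
  ultimately show ?thesis by (simp add: log_size_def)
qed

text \<open>The differential of \<open>ln |f|\<close> is \<open>Re (f' / f z * v)\<close>, and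
  \<open>Im v = Re (- \<i> * v)\<close> brings the term from \<open>ln (Im z)\<close> into the same
  form.\<close>

lemma has_derivative_log_size:
  assumes "(f has_field_derivative f') (at z)" "f z \<noteq> 0" "Im z > 0"
  shows "(log_size k f has_derivative (\<lambda>v. Re ((f' / f z - \<i> * of_real (k / (2 * Im z))) * v))) (at z)"
proof -
  have f: "(f has_derivative (\<lambda>v. f' * v)) (at z)"
    using assms(1) by (simp add: has_field_derivative_def)
  have 1: "((\<lambda>z. norm (f z)) has_derivative (\<lambda>v. inner (sgn (f z)) (f' * v))) (at z)"
    using has_derivative_compose[OF f has_derivative_norm[OF assms(2)]] by (simp add: inner_commute)
  have "((\<lambda>z. ln (norm (f z))) has_derivative (\<lambda>v. inner (sgn (f z)) (f' * v) * inverse (norm (f z)))) (at z)"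
    by (rule has_derivative_ln[OF _ 1]) (use assms(2) in auto)
  moreover have "((\<lambda>z. ln (Im z)) has_derivative (\<lambda>v. Im v * inverse (Im z))) (at z)"
    by (rule has_derivative_ln) (auto intro!: derivative_eq_intros assms)
  ultimately have "(log_size k f has_derivative
      (\<lambda>v. inner (sgn (f z)) (f' * v) * inverse (norm (f z)) + k / 2 * (Im v * inverse (Im z)))) (at z)"
    unfolding log_size_def by (intro has_derivative_add has_derivative_mult_right)
  moreover have "inner (sgn (f z)) (f' * v) * inverse (norm (f z)) + k / 2 * (Im v * inverse (Im z))
     = Re ((f' / f z - \<i> * of_real (k / (2 * Im z))) * v)" for v
  proof -
    have "Re (w / f z) = inner (sgn (f z)) w * inverse (norm (f z))" for w
      using assms(2) cmod_power2[of "f z"]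
      by (simp add: inner_complex_def sgn_div_norm Re_divide field_simps power2_eq_square)
    from this[of "f' * v"] show ?thesis by (simp add: left_diff_distrib inverse_eq_divide)
  qed
  ultimately show ?thesis by simp
qed

text \<open>The images of \<open>z\<close> under \<open>A n\<close> approach \<open>z\<close> with
  velocity \<open>moebius_field Y z\<close>, by the exact formula for their displacement, whose
  denominators tend to 1; \<open>log_size\<close> is constant along them.\<close>

lemma limit_direction_annihilates:
  assumes "f \<in> unrestricted_forms \<Gamma> k \<nu>" "multiplier_system \<Gamma> k \<nu>"
    and "limit_direction (SL2R_preimage \<Gamma>) Y" "f z \<noteq> 0"
  shows "Re ((deriv f z / f z - \<i> * of_real (k / (2 * Im z))) * moebius_field Y z) = 0"
proof -
  obtain A \<epsilon> where A: "\<And>n. A n \<in> SL2R_preimage \<Gamma>" "\<And>n. \<epsilon> n > 0" "\<epsilon> \<longlonglongrightarrow> 0"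
    and lim: "(\<lambda>n::nat. (1 / \<epsilon> n) *\<^sub>R (A n - mat 1)) \<longlonglongrightarrow> Y"
    using assms(3) unfolding limit_direction_def by blast
  have z: "z \<in> upper_half_plane" "f analytic_on {z}"
    using unrestricted_form_analytic_at[OF assms(1,4)] by blast+
  have A': "A n \<in> carrier SL2R" for n using A(1) by (simp add: SL2R_preimage_def)
  have A1: "A \<longlonglongrightarrow> mat 1" by (rule limit_direction_tendsto_1[OF A(3,2) lim])
  have "(\<lambda>n. moebius_field ((1 / \<epsilon> n) *\<^sub>R (A n - mat 1)) z / moebius_denom (A n) z)
     \<longlonglongrightarrow> moebius_field Y z / moebius_denom (mat 1) z"
    unfolding moebius_field_def moebius_denom_def
    by (intro tendsto_intros tendsto_vec_nth lim A1) auto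
  moreover have "moebius_field ((1 / \<epsilon> n) *\<^sub>R (A n - mat 1)) z / moebius_denom (A n) z
     = (1 / \<epsilon> n) *\<^sub>R (moebius_mat (A n) z - z)" for n
    unfolding moebius_mat_diff[OF moebius_denom_nonzero[OF A' z(1)]] moebius_field_scaleR
    by (simp add: scaleR_conv_of_real)
  ultimately have v: "(\<lambda>n. (1 / \<epsilon> n) *\<^sub>R (moebius_mat (A n) z - z)) \<longlonglongrightarrow> moebius_field Y z"
    by (simp add: moebius_denom_def)
  have "(f has_field_derivative deriv f z) (at z)"
    using z(2) by (simp add: analytic_at_imp_isCont analytic_on_imp_differentiable_at DERIV_deriv_iff_field_differentiable)
  hence "(log_size k f has_derivative (\<lambda>v. Re ((deriv f z / f z - \<i> * of_real (k / (2 * Im z))) * v))) (at z)"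
    by (rule has_derivative_log_size) (use assms(4) z(1) in \<open>auto simp: upper_half_plane_def\<close>)
  from has_derivative_invariant_direction[OF this A(3,2) v log_size_invariant[OF assms(1,2) A(1) assms(4)]]
  show ?thesis .
qed

section \<open>The logarithmic derivative of a form\<close>

lemma infinite_open:
  fixes S :: "complex set"
  assumes "open S" "S \<noteq> {}"
  shows "infinite S"
  using assms finite_imp_not_open by blast

text \<open>Off the finitely many zeros of the denominator the ratio is holomorphic and real, hence
  locally a real constant \<open>c\<close>. The field of \<open>Y' - c Y\<close> then vanishes on a
  disc, too large a zero set for a nonzero traceless matrix.\<close>

lemma moebius_field_ratio_real_imp_parallel:
  assumes "open S" "S \<noteq> {}" "trace Y = 0" "trace Y' = 0" "Y \<noteq> 0"
    and "\<And>z. z \<in> S \<Longrightarrow> Im (moebius_field Y' z / moebius_field Y z) = 0"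
  shows "\<exists>t. Y' = t *\<^sub>R Y"
proof -
  let ?Z = "{z. moebius_field Y z = 0}"
  have fin: "finite ?Z" by (rule finite_moebius_field_roots) fact+
  hence "open (S - ?Z)" using assms(1) by (simp add: finite_imp_closed open_Diff)
  moreover have "S - ?Z \<noteq> {}"
    using fin infinite_open[OF assms(1,2)] Diff_infinite_finite finite.emptyI by metis
  ultimately obtain z e where e: "e > 0" "ball z e \<subseteq> S - ?Z"
    by (meson ex_in_conv open_contains_ball)
  let ?r = "\<lambda>z. moebius_field Y' z / moebius_field Y z"
  have "?r holomorphic_on ball z e"
    by (intro holomorphic_intros) (use e in auto)
  hence "?r constant_on ball z e"
    by (rule holomorphic_real_imp_constant) (use e assms(6) in auto)
  then obtain c where c: "\<And>w. w \<in> ball z e \<Longrightarrow> ?r w = c"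
    by (auto simp: constant_on_def)
  have "Im (?r z) = 0" using assms(6) e by (meson DiffD1 centre_in_ball subsetD)
  hence "c = of_real (Re c)"
    using c[of z] e(1) by (simp add: complex_eq_iff)
  hence "moebius_field (Y' - Re c *\<^sub>R Y) w = 0" if "w \<in> ball z e" for w
  proof -
    have "moebius_field Y w \<noteq> 0" using e(2) that by blast
    thus ?thesis
      using c[OF that] \<open>c = of_real (Re c)\<close>
      unfolding moebius_field_diff moebius_field_scaleR by (simp add: field_simps)
  qed
  hence "ball z e \<subseteq> {w. moebius_field (Y' - Re c *\<^sub>R Y) w = 0}" by blast
  moreover have "infinite (ball z e)" using e(1) by (intro infinite_open) auto
  ultimately have "infinite {w. moebius_field (Y' - Re c *\<^sub>R Y) w = 0}"
    using finite_subset by blast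
  moreover have "trace (Y' - Re c *\<^sub>R Y) = 0"
  proof -
    have "trace (Y' - Re c *\<^sub>R Y) = trace Y' - Re c * trace Y"
      by (simp add: trace_def sum_2 algebra_simps)
    thus ?thesis using assms(3,4) by simp
  qed
  ultimately have "Y' - Re c *\<^sub>R Y = 0" using finite_moebius_field_roots by blast
  thus ?thesis by auto
qed

lemma unrestricted_form_log_deriv:
  assumes "subgroup \<Gamma> PSL2R" "\<not> elementary_PSL2R \<Gamma>" "\<not> discrete_PSL2R \<Gamma>"
    and "multiplier_system \<Gamma> k \<nu>" "f \<in> unrestricted_forms \<Gamma> k \<nu>" "f z \<noteq> 0"
  shows "deriv f z / f z = \<i> * of_real (k / (2 * Im z))"
proof (rule ccontr)
  assume neq: "\<not> ?thesis"
  let ?G = "SL2R_preimage \<Gamma>"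
  define U where "U = {z. f z \<noteq> 0}"
  have U: "open U" "f holomorphic_on U"
    unfolding U_def by (rule open_nonzero_unrestricted_form[OF assms(5)])+
  have Im: "Im z > 0" if "z \<in> U" for z
    using unrestricted_form_analytic_at(1)[OF assms(5)] that by (auto simp: U_def upper_half_plane_def)
  obtain Y where Y: "limit_direction ?G Y" "Y \<noteq> 0"
    using limit_direction_exists[OF not_discrete_PSL2R_accumulates[OF assms(1,3)]] by blast
  have tr: "trace Y = 0" by (rule trace_limit_direction[OF Y(1) SL2R_preimage_subset])
  obtain g g' where g: "g \<in> ?G" "g' \<in> ?G" "g ** g' = mat 1" "\<And>t. g ** Y ** g' \<noteq> t *\<^sub>R Y"
    using not_elementary_PSL2R_conj[OF assms(1,2) tr Y(2)] by blast
  have Y': "limit_direction ?G (g ** Y ** g')"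
    by (rule limit_direction_conj[OF Y(1) g(3)]) (intro SL2R_preimage_mult assms(1) g)
  have tr': "trace (g ** Y ** g') = 0"
    by (rule trace_limit_direction[OF Y' SL2R_preimage_subset])
  define w where "w z = deriv f z / f z - \<i> * of_real (k / (2 * Im z))" for z
  \<comment> \<open>Continuity spreads \<open>w \<noteq> 0\<close> from the given point to an open
    set.\<close>
  have "continuous_on U w"
    unfolding w_def using Im
    by (intro continuous_intros holomorphic_on_imp_continuous_on[OF U(2)]
          holomorphic_on_imp_continuous_on[OF holomorphic_deriv[OF U(2,1)]])
       (force simp: U_def)+
  hence "open (U \<inter> w -` (- {0}))"
    by (rule continuous_open_preimage) (use U in auto)
  moreover have "U \<inter> w -` (- {0}) \<noteq> {}"
    using neq assms(6) by (auto simp: U_def w_def)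
  moreover have "Im (moebius_field (g ** Y ** g') z / moebius_field Y z) = 0" if "z \<in> U \<inter> w -` (- {0})" for z
  proof -
    have "Re (w z * moebius_field Y z) = 0" "Re (w z * moebius_field (g ** Y ** g') z) = 0"
      using limit_direction_annihilates[OF assms(5,4)] Y(1) Y' that by (auto simp: w_def U_def)
    \<comment> \<open>A quotient of imaginary numbers is real, also for \<open>b = 0\<close>, where
      its value is 0; the factor \<open>w z\<close> then cancels.\<close>
    moreover have "Im (a / b) = 0" if "Re b = 0" "Re a = 0" for a b
      using that by (simp add: Im_divide)
    ultimately have "Im ((w z * moebius_field (g ** Y ** g') z) / (w z * moebius_field Y z)) = 0"
      by blast
    thus ?thesis using that by simp
  qed
  ultimately show False
    using moebius_field_ratio_real_imp_parallel[OF _ _ tr tr' Y(2)] g(4) by blast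
qed

section \<open>Weight zero and constancy\<close>

lemma unrestricted_form_nonzero_imp_weight_0:
  assumes "subgroup \<Gamma> PSL2R" "\<not> elementary_PSL2R \<Gamma>" "\<not> discrete_PSL2R \<Gamma>"
    and "multiplier_system \<Gamma> k \<nu>" "f \<in> unrestricted_forms \<Gamma> k \<nu>" "f z \<noteq> 0"
  shows "k = 0"
proof -
  note U = open_nonzero_unrestricted_form[OF assms(5)]
  obtain e where e: "e > 0" "ball z e \<subseteq> {z. f z \<noteq> 0}"
    using U(1) assms(6) by (auto simp: open_contains_ball)
  have im: "Im w > 0" if "w \<in> ball z e" for w
    using unrestricted_form_analytic_at(1)[OF assms(5)] e(2) that by (auto simp: upper_half_plane_def)
  \<comment> \<open>The factor \<open>- \<i>\<close> makes a holomorphic function real-valued, hence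
    constant on the ball.\<close>
  have eq: "- \<i> * (deriv f w / f w) = of_real (k / (2 * Im w))" if "w \<in> ball z e" for w
  proof -
    have "f w \<noteq> 0" using e(2) that by auto
    from unrestricted_form_log_deriv[OF assms(1-5) this] show ?thesis by simp
  qed
  have "(\<lambda>w. - \<i> * (deriv f w / f w)) holomorphic_on ball z e"
    using holomorphic_on_subset[OF U(2) e(2)] e(2) by (intro holomorphic_intros) auto
  hence "(\<lambda>w. - \<i> * (deriv f w / f w)) constant_on ball z e"
    by (rule holomorphic_real_imp_constant) (simp_all only: eq Im_complex_of_real open_ball connected_ball)
  then obtain c where c: "\<And>w. w \<in> ball z e \<Longrightarrow> of_real (k / (2 * Im w)) = (c::complex)"
    using eq by (auto simp: constant_on_def)
  \<comment> \<open>A point straight above \<open>z\<close>: equal values of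
    \<open>k / (2 * Im w)\<close> at two heights force \<open>k = 0\<close>.\<close>
  define z' where "z' = z + of_real (e / 2) * \<i>"
  have z': "z' \<in> ball z e" "z \<in> ball z e" using e(1) by (simp_all add: z'_def dist_norm norm_mult)
  have "complex_of_real (k / (2 * Im z')) = of_real (k / (2 * Im z))" using c z' by metis
  hence "k / (2 * Im z') = k / (2 * Im z)" by (simp only: of_real_eq_iff)
  hence "k * (Im z' - Im z) = 0" using im[OF z'(1)] im[OF z'(2)] by (simp add: field_simps)
  thus "k = 0" using e(1) by (simp add: z'_def)
qed

text \<open>The derivative is known to vanish only where \<open>f\<close> is nonzero. Connectedness
  of the half-plane is therefore applied to the level set of one nonzero value and its complement,
  both open.\<close>

lemma unrestricted_form_constant:
  assumes "subgroup \<Gamma> PSL2R" "\<not> elementary_PSL2R \<Gamma>" "\<not> discrete_PSL2R \<Gamma>"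
    and "multiplier_system \<Gamma> k \<nu>" "f \<in> unrestricted_forms \<Gamma> k \<nu>"
  shows "f \<in> range const_uhp"
proof (cases "\<exists>z. f z \<noteq> 0")
  case False
  hence "f = const_uhp 0" by (auto simp: const_uhp_def)
  thus ?thesis by blast
next
  case True
  then obtain z where z: "f z \<noteq> 0" by blast
  have f: "f nicely_meromorphic_on upper_half_plane" "\<And>z. z \<notin> upper_half_plane \<Longrightarrow> f z = 0"
    using assms(5) by (auto simp: unrestricted_forms_def meromorphic_on_uhp_def)
  have "k = 0" by (rule unrestricted_form_nonzero_imp_weight_0[OF assms z])
  hence deriv: "deriv f w = 0" if "f w \<noteq> 0" for w
    using unrestricted_form_log_deriv[OF assms that] that by simp
  note U = open_nonzero_unrestricted_form[OF assms(5)]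
  \<comment> \<open>Because \<open>f z \<noteq> 0\<close>, all of \<open>?S\<close> lies in the
    half-plane and avoids the poles.\<close>
  let ?S = "{w. f w = f z}" and ?T = "{w \<in> upper_half_plane. f w \<noteq> f z}"
  have "open ?S"
  proof (subst open_contains_ball, intro ballI)
    fix w assume w: "w \<in> ?S"
    hence "w \<in> {z. f z \<noteq> 0}" using z by simp
    then obtain e where e: "e > 0" "ball w e \<subseteq> {z. f z \<noteq> 0}"
      using openE[OF U(1)] by blast
    have "(f has_field_derivative 0) (at x within ball w e)" if "x \<in> ball w e" for x
    proof -
      have x: "f x \<noteq> 0" using e(2) that by auto
      hence "(f has_field_derivative deriv f x) (at x)"
        using holomorphic_derivI[OF U(2,1)] by simp
      thus ?thesis using deriv[OF x] by (simp add: has_field_derivative_at_within)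
    qed
    then obtain c where c: "\<And>x. x \<in> ball w e \<Longrightarrow> f x = c"
      using has_field_derivative_zero_constant[of "ball w e" f] by auto
    hence "ball w e \<subseteq> ?S" using e(1) w by (metis centre_in_ball mem_Collect_eq subsetI)
    thus "\<exists>e>0. ball w e \<subseteq> ?S" using e(1) by blast
  qed
  moreover have "open ?T"
  proof (subst open_subopen, intro ballI)
    fix w assume w: "w \<in> ?T"
    \<comment> \<open>Near \<open>w\<close>, \<open>f\<close> tends to \<open>f w\<close>, which
      differs from \<open>f z\<close>, or to infinity if \<open>w\<close> is a pole.\<close>
    have "\<forall>\<^sub>F x in at w. f x \<noteq> f z"
      using f(1) w unfolding nicely_meromorphic_on_def is_pole_def
      by (auto intro: filterlim_at_infinity_imp_eventually_ne tendsto_imp_eventually_ne)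
    hence "\<forall>\<^sub>F x in nhds w. f x \<noteq> f z"
      using w by (simp add: eventually_nhds_conv_at)
    moreover have "\<forall>\<^sub>F x in nhds w. x \<in> upper_half_plane"
      using w open_upper_half_plane by (intro eventually_nhds_in_open) auto
    ultimately have "\<forall>\<^sub>F x in nhds w. x \<in> ?T" by eventually_elim simp
    thus "\<exists>T. open T \<and> w \<in> T \<and> T \<subseteq> ?T" unfolding eventually_nhds by blast
  qed
  ultimately have "?S \<inter> upper_half_plane = {} \<or> ?T \<inter> upper_half_plane = {}"
    by (intro connectedD[OF connected_upper_half_plane]) auto
  moreover have "z \<in> upper_half_plane" using f(2) z by blast
  ultimately have "\<forall>w\<in>upper_half_plane. f w = f z" by blast
  hence "f = const_uhp (f z)" using f(2) by (auto simp: const_uhp_def)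
  thus ?thesis by blast
qed

section \<open>Constant functions as forms and the classification\<close>

lemma const_uhp_in_unrestricted_forms:
  assumes "w = 0 \<or> k = 0 \<and> (\<forall>A\<in>SL2R_preimage \<Gamma>. \<nu> A = 1)"
  shows "const_uhp w \<in> unrestricted_forms \<Gamma> k \<nu>"
proof -
  have "const_uhp w holomorphic_on upper_half_plane"
    by (rule holomorphic_transform[of "\<lambda>_. w"]) (auto simp: const_uhp_def)
  hence "const_uhp w nicely_meromorphic_on upper_half_plane"
    using open_upper_half_plane by (simp add: analytic_on_open analytic_on_imp_nicely_meromorphic_on)
  moreover have "moebius_denom A z powr of_real (- k) * const_uhp w (moebius_mat A z) = \<nu> A * const_uhp w z"
    if "A \<in> SL2R_preimage \<Gamma>" "z \<in> upper_half_plane" for A z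
  proof -
    have "A \<in> carrier SL2R" using that(1) SL2R_preimage_subset by blast
    \<comment> \<open>The denominator has to be nonzero here: \<open>x powr 0\<close> is 1 only for
      \<open>x \<noteq> 0\<close>.\<close>
    thus ?thesis
      using assms that moebius_mat_in_upper_half_plane[of A z] moebius_denom_nonzero[of A z]
      by (auto simp: const_uhp_def)
  qed
  ultimately show ?thesis
    by (auto simp: unrestricted_forms_def meromorphic_on_uhp_def const_uhp_def)
qed

theorem theorem9p2:
  fixes \<Gamma> :: "(real^2^2) set set" and k :: real and \<nu> :: "real^2^2 \<Rightarrow> complex"
  assumes "subgroup \<Gamma> PSL2R"
    and "\<not> elementary_PSL2R \<Gamma>"
    and "\<not> discrete_PSL2R \<Gamma>"
    and "multiplier_system \<Gamma> k \<nu>"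
  shows "(k \<noteq> 0 \<longrightarrow> unrestricted_forms \<Gamma> k \<nu> = {const_uhp 0}) \<and>
         (k = 0 \<longrightarrow>
            ((\<forall>A\<in>SL2R_preimage \<Gamma>. \<nu> A = 1) \<longrightarrow> unrestricted_forms \<Gamma> k \<nu> = range const_uhp) \<and>
            (\<not> (\<forall>A\<in>SL2R_preimage \<Gamma>. \<nu> A = 1) \<longrightarrow> unrestricted_forms \<Gamma> k \<nu> = {const_uhp 0}))"
proof -
  have const: "\<exists>w. f = const_uhp w" if "f \<in> unrestricted_forms \<Gamma> k \<nu>" for f
    using unrestricted_form_constant[OF assms that] by blast
  have trivial: "k = 0 \<and> (\<forall>A\<in>SL2R_preimage \<Gamma>. \<nu> A = 1)"
    if w: "const_uhp w \<in> unrestricted_forms \<Gamma> k \<nu>" "w \<noteq> 0" for w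
  proof -
    have i: "\<i> \<in> upper_half_plane" by (simp add: upper_half_plane_def)
    have k: "k = 0"
      by (rule unrestricted_form_nonzero_imp_weight_0[OF assms w(1), of \<i>])
         (use i w(2) in \<open>simp add: const_uhp_def\<close>)
    moreover have "\<nu> A = 1" if A: "A \<in> SL2R_preimage \<Gamma>" for A
    proof -
      have A': "A \<in> carrier SL2R" using A SL2R_preimage_subset by blast
      \<comment> \<open>In weight 0 the law for a constant, read at \<open>\<i>\<close>, becomes
        \<open>w = \<nu> A * w\<close>.\<close>
      have "moebius_denom A \<i> powr of_real (- k) * const_uhp w (moebius_mat A \<i>) = \<nu> A * const_uhp w \<i>"
        using w(1) A i by (auto simp: unrestricted_forms_def)
      thus ?thesis
        using k i w(2) moebius_mat_in_upper_half_plane[OF A' i] moebius_denom_nonzero[OF A' i]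
        by (simp add: const_uhp_def)
    qed
    ultimately show ?thesis by blast
  qed
  show ?thesis
    using const trivial const_uhp_in_unrestricted_forms[of _ k \<Gamma> \<nu>] by (auto; metis)
qed

end
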